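(* For every $\tau\in\{132,213\}$, as formal power series in $z$, $$F(123,\tau;q,z)=1+\frac{z(1-qz)}{(1-z)(1-(1+q)z)}.$$
   Context: $S_n$ is the set of permutations of $[n]=\{1,\ldots,n\}$ (with $S_0$ consisting of the empty permutation, which has no crossing). A permutation $\sigma\in S_n$ avoids a pattern $\tau\in S_m$ if no subsequence $\sigma(i_1)\cdots\sigma(i_m)$ with $i_1<\cdots<i_m$ is in the same relative order as $\tau$; $S_n(\tau_1,\tau_2)$ is the set of $\sigma\in S_n$ avoiding both $\tau_1$ and $\tau_2$. A crossing of $\sigma$ is a pair $(i,j)$ with $i<j<\sigma(i)<\sigma(j)$ or $\sigma(i)<\sigma(j)\leq i<j$; $\mathrm{cr}(\sigma)$ is the number of crossings. Put $$F(\tau_1,\tau_2;q,z)=\sum_{n\geq 0}\Big(\sum_{\sigma\in S_n(\tau_1,\tau_2)}q^{\mathrm{cr}(\sigma)}\Big)z^n.$$ *)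

theory Defs
  imports
    "HOL-Combinatorics.Permutations"
    "HOL-Computational_Algebra.Formal_Power_Series"
begin

(* A permutation of [n] is a function s :: nat => nat with s permutes {1..n}; it is the identity
   outside [n], so for n = 0 there is exactly one.  A pattern is given by its one-line word,
   e.g. [1,3,2] for 132; positions in the word are counted from 0. *)

definition contains_pattern :: "nat \<Rightarrow> (nat \<Rightarrow> nat) \<Rightarrow> nat list \<Rightarrow> bool" where
  "contains_pattern n \<sigma> \<tau> \<longleftrightarrow>
     (\<exists>\<iota> :: nat \<Rightarrow> nat.
        strict_mono_on {..<length \<tau>} \<iota> \<and> \<iota> ` {..<length \<tau>} \<subseteq> {1..n} \<and>
        (\<forall>a<length \<tau>. \<forall>b<length \<tau>. \<sigma> (\<iota> a) < \<sigma> (\<iota> b) \<longleftrightarrow> \<tau> ! a < \<tau> ! b))"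

definition avoiders :: "nat \<Rightarrow> nat list \<Rightarrow> nat list \<Rightarrow> (nat \<Rightarrow> nat) set" where
  "avoiders n \<tau>\<^sub>1 \<tau>\<^sub>2 =
     {\<sigma>. \<sigma> permutes {1..n} \<and> \<not> contains_pattern n \<sigma> \<tau>\<^sub>1 \<and> \<not> contains_pattern n \<sigma> \<tau>\<^sub>2}"

definition crossings :: "nat \<Rightarrow> (nat \<Rightarrow> nat) \<Rightarrow> (nat \<times> nat) set" where
  "crossings n \<sigma> =
     {(i, j). i \<in> {1..n} \<and> j \<in> {1..n} \<and>
        (i < j \<and> j < \<sigma> i \<and> \<sigma> i < \<sigma> j \<or> \<sigma> i < \<sigma> j \<and> \<sigma> j \<le> i \<and> i < j)}"

definition cr :: "nat \<Rightarrow> (nat \<Rightarrow> nat) \<Rightarrow> nat" where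
  "cr n \<sigma> = card (crossings n \<sigma>)"

(* The formal power series variable is z.  The second variable q is an arbitrary element of the
   coefficient structure; the indeterminate q is the instance where the coefficients are rational
   functions and q is their variable. *)
definition F :: "nat list \<Rightarrow> nat list \<Rightarrow> 'a::comm_semiring_1 \<Rightarrow> 'a fps" where
  "F \<tau>\<^sub>1 \<tau>\<^sub>2 q = Abs_fps (\<lambda>n. \<Sum>\<sigma>\<in>avoiders n \<tau>\<^sub>1 \<tau>\<^sub>2. q ^ cr n \<sigma>)"

end

(* Avoiding 123 and 132 means that every position has at most one larger value to its right.  Such a
   permutation is determined by the set A of positions that are not right-to-left maxima, and A can
   be any subset of {1..n-1}.  Each i in A has exactly one larger value to its right, at the next
   right-to-left maximum, and this pair is a crossing iff some b outside A satisfies i < b < n - i or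
   n - i <= b < i.  Ordering {1..n-1} from the middle outwards, these b are exactly the elements
   before i; so the crossings are counted by the elements of A after the first gap of A, and the
   position of that gap gives the sum 1 + sum_(k < n-1) (1+q)^k.  The pattern 213 reduces to 132 by
   the reverse-complement-inverse symmetry. *)

theory Submission
  imports Defs
begin

section \<open>Pattern avoidance as uniqueness of a larger or smaller entry\<close>

text \<open>A strictly increasing map on three indices is a triple \<open>i < j < k\<close>.
  Comparing an index with itself gives nothing, so six comparisons remain.\<close>

lemma contains_pattern_3_iff:
  "contains_pattern n \<sigma> [x, y, z] \<longleftrightarrow>
     (\<exists>i j k. 1 \<le> i \<and> i < j \<and> j < k \<and> k \<le> n \<and>
        (\<sigma> i < \<sigma> j \<longleftrightarrow> x < y) \<and> (\<sigma> j < \<sigma> i \<longleftrightarrow> y < x) \<and>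
        (\<sigma> i < \<sigma> k \<longleftrightarrow> x < z) \<and> (\<sigma> k < \<sigma> i \<longleftrightarrow> z < x) \<and>
        (\<sigma> j < \<sigma> k \<longleftrightarrow> y < z) \<and> (\<sigma> k < \<sigma> j \<longleftrightarrow> z < y))"
  (is "_ \<longleftrightarrow> (\<exists>i j k. ?P i j k)")
proof
  have len: "{..<length [x, y, z]} = {0, 1, 2}"
    by auto
  {
    assume "contains_pattern n \<sigma> [x, y, z]"
    then obtain \<iota> where \<iota>: "strict_mono_on {0, 1, 2::nat} \<iota>" "\<iota> ` {0, 1, 2} \<subseteq> {1..n}"
      and ord: "\<And>a b. a < 3 \<Longrightarrow> b < 3 \<Longrightarrow> \<sigma> (\<iota> a) < \<sigma> (\<iota> b) \<longleftrightarrow> [x, y, z] ! a < [x, y, z] ! b"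
      unfolding contains_pattern_def len by auto
    have "\<iota> 0 < \<iota> 1" "\<iota> 1 < \<iota> 2"
      using \<iota>(1) by (auto intro: strict_mono_onD)
    then have "?P (\<iota> 0) (\<iota> 1) (\<iota> 2)"
      using \<iota>(2) ord[of 0 1] ord[of 1 0] ord[of 0 2] ord[of 2 0] ord[of 1 2] ord[of 2 1] by simp
    then show "\<exists>i j k. ?P i j k"
      by blast
  }
  {
    assume "\<exists>i j k. ?P i j k"
    then obtain i j k where P: "?P i j k"
      by blast
    let ?\<iota> = "\<lambda>a. [i, j, k] ! a"
    have "strict_mono_on {0, 1, 2} ?\<iota>" "?\<iota> ` {0, 1, 2} \<subseteq> {1..n}"
      using P by (auto simp: strict_mono_on_def)
    moreover have "\<forall>a\<in>{0, 1, 2}. \<forall>b\<in>{0, 1, 2}.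
        \<sigma> (?\<iota> a) < \<sigma> (?\<iota> b) \<longleftrightarrow> [x, y, z] ! a < [x, y, z] ! b"
      using P by simp
    ultimately show "contains_pattern n \<sigma> [x, y, z]"
      unfolding contains_pattern_def by (metis len lessThan_iff)
  }
qed

text \<open>The patterns 123 and 132 share the shape of an entry followed by two larger ones.
  Leaving \<open>j\<close> and \<open>k\<close> unordered treats both at once.\<close>

definition unique_larger_right :: "nat \<Rightarrow> (nat \<Rightarrow> nat) \<Rightarrow> bool" where
  "unique_larger_right n \<sigma> \<longleftrightarrow>
     (\<forall>i j k. 1 \<le> i \<and> i < j \<and> i < k \<and> j \<le> n \<and> k \<le> n \<and> \<sigma> i < \<sigma> j \<and> \<sigma> i < \<sigma> k \<longrightarrow> j = k)"

definition unique_smaller_left :: "nat \<Rightarrow> (nat \<Rightarrow> nat) \<Rightarrow> bool" where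
  "unique_smaller_left n \<sigma> \<longleftrightarrow>
     (\<forall>i j k. 1 \<le> i \<and> 1 \<le> j \<and> i < k \<and> j < k \<and> k \<le> n \<and> \<sigma> i < \<sigma> k \<and> \<sigma> j < \<sigma> k \<longrightarrow> i = j)"

text \<open>Two larger entries to the right of an entry appear in increasing or in decreasing order,
  which gives 123 or 132.\<close>

lemma avoiders_123_132:
  "avoiders n [1, 2, 3] [1, 3, 2] = {\<sigma>. \<sigma> permutes {1..n} \<and> unique_larger_right n \<sigma>}"
proof -
  have "\<not> contains_pattern n \<sigma> [1, 2, 3] \<and> \<not> contains_pattern n \<sigma> [1, 3, 2]
      \<longleftrightarrow> unique_larger_right n \<sigma>"
    if "\<sigma> permutes {1..n}" for \<sigma>
  proof -
    have inj: "\<sigma> i = \<sigma> j \<longleftrightarrow> i = j" for i j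
      using permutes_inj[OF that] by (auto dest: injD)
    have "contains_pattern n \<sigma> [1, 2, 3] \<longleftrightarrow>
        (\<exists>i j k. 1 \<le> i \<and> i < j \<and> j < k \<and> k \<le> n \<and> \<sigma> i < \<sigma> j \<and> \<sigma> j < \<sigma> k)"
      "contains_pattern n \<sigma> [1, 3, 2] \<longleftrightarrow>
        (\<exists>i j k. 1 \<le> i \<and> i < j \<and> j < k \<and> k \<le> n \<and> \<sigma> i < \<sigma> k \<and> \<sigma> k < \<sigma> j)"
      unfolding contains_pattern_3_iff by (intro ex_cong1; force)+
    moreover have "unique_larger_right n \<sigma> \<longleftrightarrow>
        (\<forall>i j k. 1 \<le> i \<and> i < j \<and> j < k \<and> k \<le> n \<longrightarrow> \<not> (\<sigma> i < \<sigma> j \<and> \<sigma> i < \<sigma> k))"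
      unfolding unique_larger_right_def
    proof (intro iffI allI impI, goal_cases)
      case (1 i j k)
      then show ?case
        by (metis less_imp_le less_irrefl less_trans le_trans)
    next
      case (2 i j k)
      then show ?case
        by (cases j k rule: linorder_cases) blast+
    qed
    moreover have "\<sigma> i < \<sigma> j \<and> \<sigma> i < \<sigma> k \<longleftrightarrow>
        \<sigma> i < \<sigma> j \<and> \<sigma> j < \<sigma> k \<or> \<sigma> i < \<sigma> k \<and> \<sigma> k < \<sigma> j"
      if "i < j" "j < k" for i j k
      using that inj[of j k] by auto
    ultimately show ?thesis
      by blast
  qed
  then show ?thesis
    unfolding avoiders_def by blast
qed

text \<open>The shared shape is now two entries followed by a larger one; the order of those two
  distinguishes 123 from 213.\<close>

lemma avoiders_123_213:
  "avoiders n [1, 2, 3] [2, 1, 3] = {\<sigma>. \<sigma> permutes {1..n} \<and> unique_smaller_left n \<sigma>}"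
proof -
  have "\<not> contains_pattern n \<sigma> [1, 2, 3] \<and> \<not> contains_pattern n \<sigma> [2, 1, 3]
      \<longleftrightarrow> unique_smaller_left n \<sigma>"
    if "\<sigma> permutes {1..n}" for \<sigma>
  proof -
    have inj: "\<sigma> i = \<sigma> j \<longleftrightarrow> i = j" for i j
      using permutes_inj[OF that] by (auto dest: injD)
    have "contains_pattern n \<sigma> [1, 2, 3] \<longleftrightarrow>
        (\<exists>i j k. 1 \<le> i \<and> i < j \<and> j < k \<and> k \<le> n \<and> \<sigma> i < \<sigma> j \<and> \<sigma> j < \<sigma> k)"
      "contains_pattern n \<sigma> [2, 1, 3] \<longleftrightarrow>
        (\<exists>i j k. 1 \<le> i \<and> i < j \<and> j < k \<and> k \<le> n \<and> \<sigma> j < \<sigma> i \<and> \<sigma> i < \<sigma> k)"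
      unfolding contains_pattern_3_iff by (intro ex_cong1; force)+
    moreover have "unique_smaller_left n \<sigma> \<longleftrightarrow>
        (\<forall>i j k. 1 \<le> i \<and> i < j \<and> j < k \<and> k \<le> n \<longrightarrow> \<not> (\<sigma> i < \<sigma> k \<and> \<sigma> j < \<sigma> k))"
      unfolding unique_smaller_left_def
    proof (intro iffI allI impI, goal_cases)
      case (1 i j k)
      then show ?case
        by (metis less_imp_le less_irrefl less_trans le_trans)
    next
      case (2 i j k)
      then show ?case
        by (cases i j rule: linorder_cases) blast+
    qed
    moreover have "\<sigma> i < \<sigma> k \<and> \<sigma> j < \<sigma> k \<longleftrightarrow>
        \<sigma> i < \<sigma> j \<and> \<sigma> j < \<sigma> k \<or> \<sigma> j < \<sigma> i \<and> \<sigma> i < \<sigma> k"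
      if "i < j" "j < k" for i j k
      using that inj[of i j] by auto
    ultimately show ?thesis
      by blast
  qed
  then show ?thesis
    unfolding avoiders_def by blast
qed

section \<open>Bijection with the subsets of {1..n-1}\<close>

definition non_rl_maxima :: "nat \<Rightarrow> (nat \<Rightarrow> nat) \<Rightarrow> nat set" where
  "non_rl_maxima n \<sigma> = {i. 1 \<le> i \<and> (\<exists>j. i < j \<and> j \<le> n \<and> \<sigma> i < \<sigma> j)}"

lemma non_rl_maxima_subset: "non_rl_maxima n \<sigma> \<subseteq> {1..n - 1}"
  by (auto simp: non_rl_maxima_def)

text \<open>If \<open>\<sigma> i < \<sigma> j\<close>, a larger entry right of \<open>j\<close>, or
  an entry between \<open>i\<close> and \<open>j\<close> exceeding \<open>\<sigma> j\<close>, would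
  be a second larger entry for \<open>i\<close>. So \<open>j\<close> is the first right-to-left
  maximum after \<open>i\<close>, and the set determines every comparison.\<close>

lemma less_iff_next_rl_maximum:
  assumes "\<sigma> permutes {1..n}" "unique_larger_right n \<sigma>" "1 \<le> i" "i < j" "j \<le> n"
  shows "\<sigma> i < \<sigma> j \<longleftrightarrow> j \<notin> non_rl_maxima n \<sigma> \<and> {i..<j} \<subseteq> non_rl_maxima n \<sigma>"
proof -
  have uniq: "b = c"
    if "1 \<le> a" "a < b" "a < c" "b \<le> n" "c \<le> n" "\<sigma> a < \<sigma> b" "\<sigma> a < \<sigma> c" for a b c
    using assms(2) that unfolding unique_larger_right_def by blast
  have inj: "\<sigma> a = \<sigma> b \<longleftrightarrow> a = b" for a b
    using permutes_inj[OF assms(1)] by (auto dest: injD)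
  have next_max: "b \<notin> non_rl_maxima n \<sigma> \<and> {a..<b} \<subseteq> non_rl_maxima n \<sigma>"
    if "1 \<le> a" "a < b" "b \<le> n" "\<sigma> a < \<sigma> b" for a b
  proof
    show "b \<notin> non_rl_maxima n \<sigma>"
    proof
      assume "b \<in> non_rl_maxima n \<sigma>"
      then obtain c where "b < c" "c \<le> n" "\<sigma> b < \<sigma> c"
        by (auto simp: non_rl_maxima_def)
      with uniq[of a b c] that show False
        by simp
    qed
    show "{a..<b} \<subseteq> non_rl_maxima n \<sigma>"
    proof
      fix k assume k: "k \<in> {a..<b}"
      have "\<sigma> k < \<sigma> b"
      proof (rule ccontr)
        assume "\<not> \<sigma> k < \<sigma> b"
        with that k have "\<sigma> a < \<sigma> k" "a < k"
          by (auto simp: le_less)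
        with uniq[of a b k] that k show False
          by auto
      qed
      with that k show "k \<in> non_rl_maxima n \<sigma>"
        by (auto simp: non_rl_maxima_def)
    qed
  qed
  show ?thesis
  proof
    assume R: "j \<notin> non_rl_maxima n \<sigma> \<and> {i..<j} \<subseteq> non_rl_maxima n \<sigma>"
    with assms(4) have "i \<in> non_rl_maxima n \<sigma>"
      by auto
    then obtain k where k: "i < k" "k \<le> n" "\<sigma> i < \<sigma> k"
      by (auto simp: non_rl_maxima_def)
    \<comment> \<open>Both are the first position after \<open>i\<close> outside the set.\<close>
    have "k = j"
      using next_max[OF assms(3) k] R k(1) assms(4)
      by (metis atLeastLessThan_iff less_imp_le linorder_neqE_nat subsetD)
    with k show "\<sigma> i < \<sigma> j"
      by simp
  qed (use next_max assms in blast)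
qed

text \<open>The value at \<open>i\<close> is the number of positions whose value is at most
  \<open>\<sigma> i\<close>, and this number depends on comparisons only.\<close>

lemma permutes_eq_if_same_order:
  fixes n :: nat
  assumes "\<sigma> permutes {1..n}" "\<tau> permutes {1..n}"
    and ord: "\<And>i j. 1 \<le> i \<Longrightarrow> i < j \<Longrightarrow> j \<le> n \<Longrightarrow> \<sigma> i < \<sigma> j \<longleftrightarrow> \<tau> i < \<tau> j"
  shows "\<sigma> = \<tau>"
proof
  fix i
  have val: "\<pi> i = card {j \<in> {1..n}. \<pi> j \<le> \<pi> i}"
    if \<pi>: "\<pi> permutes {1..n}" and i: "i \<in> {1..n}" for \<pi>
  proof -
    have "\<pi> ` {j \<in> {1..n}. \<pi> j \<le> \<pi> i} = \<pi> ` {1..n} \<inter> {..\<pi> i}"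
      by blast
    also have "\<dots> = {1..\<pi> i}"
      using permutes_image[OF \<pi>] permutes_in_image[OF \<pi>, of i] i by auto
    finally show ?thesis
      using card_image[of \<pi> "{j \<in> {1..n}. \<pi> j \<le> \<pi> i}"] permutes_inj_on[OF \<pi>]
      by (metis card_atLeastAtMost diff_Suc_1)
  qed
  show "\<sigma> i = \<tau> i"
  proof (cases "i \<in> {1..n}")
    case True
    have inj: "\<sigma> a = \<sigma> b \<longleftrightarrow> a = b" "\<tau> a = \<tau> b \<longleftrightarrow> a = b" for a b
      using permutes_inj[OF assms(1)] permutes_inj[OF assms(2)] by (auto dest: injD)
    have "\<sigma> j \<le> \<sigma> i \<longleftrightarrow> \<tau> j \<le> \<tau> i" if "j \<in> {1..n}" for j
      using ord[of i j] ord[of j i] inj True that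
      by (cases i j rule: linorder_cases) (auto simp: le_less not_less_iff_gr_or_eq)
    then have "{j \<in> {1..n}. \<sigma> j \<le> \<sigma> i} = {j \<in> {1..n}. \<tau> j \<le> \<tau> i}"
      by blast
    with val[OF assms(1) True] val[OF assms(2) True] show ?thesis
      by simp
  next
    case False
    with assms show ?thesis
      by (metis permutes_not_in)
  qed
qed

lemma inj_on_non_rl_maxima:
  "inj_on (non_rl_maxima n) {\<sigma>. \<sigma> permutes {1..n} \<and> unique_larger_right n \<sigma>}"
  by (rule inj_onI) (auto intro!: permutes_eq_if_same_order[of _ n] simp: less_iff_next_rl_maximum)

text \<open>The right-to-left maxima cut the permutation into blocks, each ending at a maximum.  The values
  of a block at positions \<open>s + 1, \<dots>, j\<close> are \<open>n - s - 1, n - s - 2, \<dots>, n - j + 1, n - s\<close>.\<close>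
definition prev_max :: "nat set \<Rightarrow> nat \<Rightarrow> nat" where
  "prev_max A i = Max (insert 0 ({1..<i} - A))"

definition perm_of_non_rl_maxima :: "nat \<Rightarrow> nat set \<Rightarrow> nat \<Rightarrow> nat" where
  "perm_of_non_rl_maxima n A i =
     (if i \<in> {1..n} then (if i \<in> A then n - i else n - prev_max A i) else i)"

lemma prev_max_less: "1 \<le> i \<Longrightarrow> prev_max A i < i"
  by (auto simp: prev_max_def)

lemma prev_max_ge: "1 \<le> j \<Longrightarrow> j < i \<Longrightarrow> j \<notin> A \<Longrightarrow> j \<le> prev_max A i"
  by (auto simp: prev_max_def)

lemma prev_max_notin: "0 \<notin> A \<Longrightarrow> prev_max A i \<notin> A"
  using Max_in[of "insert 0 ({1..<i} - A)"] by (auto simp: prev_max_def)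

text \<open>By the fact \<open>less\<close>, an earlier entry is below a later one exactly when the
  later position ends the block containing the earlier one. Uniqueness and the recovery of
  \<open>A\<close> follow from this.\<close>

lemma perm_of_non_rl_maxima:
  assumes A: "A \<subseteq> {1..n - 1}"
  defines "\<sigma> \<equiv> perm_of_non_rl_maxima n A"
  shows "\<sigma> permutes {1..n}" "unique_larger_right n \<sigma>" "non_rl_maxima n \<sigma> = A"
proof -
  have An: "i < n" if "i \<in> A" for i
    using subsetD[OF A that] by auto
  \<comment> \<open>In the first block \<open>prev_max\<close> takes the default 0, which must also
    count as lying outside \<open>A\<close>.\<close>
  have A0: "0 \<notin> A"
    using A by auto
  have less: "\<sigma> i < \<sigma> j \<longleftrightarrow> i \<in> A \<and> j \<notin> A \<and> prev_max A j < i"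
    and neq: "\<sigma> i \<noteq> \<sigma> j" if ij: "1 \<le> i" "i < j" "j \<le> n" for i j
  proof -
    have p: "prev_max A i < i" "prev_max A j < j" "i \<notin> A \<Longrightarrow> i \<le> prev_max A j"
      using prev_max_less prev_max_ge ij by auto
    \<comment> \<open>Equal values \<open>n - i\<close> and \<open>n - prev_max A j\<close> would
      put \<open>prev_max A j\<close> into \<open>A\<close>.\<close>
    have ne: "i \<in> A \<Longrightarrow> prev_max A j \<noteq> i"
      using prev_max_notin[OF A0, of j] by auto
    show "\<sigma> i < \<sigma> j \<longleftrightarrow> i \<in> A \<and> j \<notin> A \<and> prev_max A j < i"
      using p ij by (auto simp: \<sigma>_def perm_of_non_rl_maxima_def)
    show "\<sigma> i \<noteq> \<sigma> j"
      using p ij ne by (auto simp: \<sigma>_def perm_of_non_rl_maxima_def)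
  qed
  show "\<sigma> permutes {1..n}"
  proof (rule bij_imp_permutes)
    have "inj_on \<sigma> {1..n}"
      by (rule linorder_inj_onI) (use neq in auto)
    \<comment> \<open>For \<open>i\<close> in \<open>A\<close> the value \<open>n - i\<close> is at
      least 1, because \<open>i < n\<close>.\<close>
    moreover have "\<sigma> ` {1..n} \<subseteq> {1..n}"
    proof
      fix y assume "y \<in> \<sigma> ` {1..n}"
      then obtain i where "1 \<le> i" "i \<le> n" "y = \<sigma> i"
        by auto
      then show "y \<in> {1..n}"
        using prev_max_less[of i A] An[of i] by (auto simp: \<sigma>_def perm_of_non_rl_maxima_def)
    qed
    ultimately show "bij_betw \<sigma> {1..n} {1..n}"
      by (simp add: bij_betw_def endo_inj_surj)
  qed (auto simp: \<sigma>_def perm_of_non_rl_maxima_def)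
  show "unique_larger_right n \<sigma>"
    unfolding unique_larger_right_def
  proof clarify
    fix i j k
    assume *: "1 \<le> i" "i < j" "i < k" "j \<le> n" "k \<le> n" "\<sigma> i < \<sigma> j" "\<sigma> i < \<sigma> k"
    then have "j \<notin> A" "k \<notin> A" "prev_max A j < i" "prev_max A k < i"
      using less by auto
    \<comment> \<open>If \<open>j < k\<close>, then \<open>j \<le> prev_max A k < i\<close>, against
      \<open>i < j\<close>; the other order is symmetric.\<close>
    with * prev_max_ge[of j k A] prev_max_ge[of k j A] show "j = k"
      by (cases j k rule: linorder_cases) auto
  qed
  show "non_rl_maxima n \<sigma> = A"
  proof (rule set_eqI, rule iffI)
    fix i assume "i \<in> non_rl_maxima n \<sigma>"
    then show "i \<in> A"
      using less by (auto simp: non_rl_maxima_def)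
  next
    fix i assume i: "i \<in> A"
    \<comment> \<open>The larger entry to the right of \<open>i\<close> is the end of its block,
      which exists because \<open>n\<close> is not in \<open>A\<close>.\<close>
    define j where "j = (LEAST j. i < j \<and> j \<notin> A)"
    have ex: "i < n \<and> n \<notin> A"
      using An i by auto
    then have "i < j \<and> j \<notin> A" "j \<le> n"
      unfolding j_def by (rule LeastI, rule Least_le)
    then have j: "i < j" "j \<notin> A" "j \<le> n"
      by auto
    have "prev_max A j < i"
    proof (rule ccontr)
      assume "\<not> prev_max A j < i"
      then have "i < prev_max A j"
        using prev_max_notin[OF A0, of j] i by (cases "i = prev_max A j") auto
      then have "j \<le> prev_max A j"
        using prev_max_notin[OF A0, of j] unfolding j_def by (intro Least_le) auto
      with prev_max_less[of j A] j show False
        by simp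
    qed
    with j i less[of i j] A show "i \<in> non_rl_maxima n \<sigma>"
      by (auto simp: non_rl_maxima_def)
  qed
qed

lemma bij_betw_non_rl_maxima:
  "bij_betw (non_rl_maxima n) (avoiders n [1, 2, 3] [1, 3, 2]) (Pow {1..n - 1})"
  unfolding bij_betw_def avoiders_123_132
proof (intro conjI inj_on_non_rl_maxima equalityI subsetI)
  fix A assume "A \<in> Pow {1..n - 1}"
  then show "A \<in> non_rl_maxima n ` {\<sigma>. \<sigma> permutes {1..n} \<and> unique_larger_right n \<sigma>}"
    using perm_of_non_rl_maxima[of A n] by (auto intro!: image_eqI[OF sym])
qed (use non_rl_maxima_subset in auto)

section \<open>Crossings and gaps ranked from the middle\<close>

text \<open>Ranks \<open>1, \<dots>, n - 1\<close> from the middle outwards: \<open>h, h - 1, h + 1, h - 2, \<dots>\<close> if \<open>n = 2h\<close> and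
  \<open>h, h + 1, h - 1, h + 2, \<dots>\<close> if \<open>n = 2h + 1\<close>.\<close>
definition middle_rank :: "nat \<Rightarrow> nat \<Rightarrow> nat" where
  "middle_rank n t = (if 2 * t < n then n - 2 * t - 1 else 2 * t - n)"

text \<open>The two branches cannot collide: \<open>n - 2 * t - 1\<close> and
  \<open>2 * t - n\<close> have opposite parity.\<close>

lemma inj_on_middle_rank: "inj_on (middle_rank n) X"
proof (rule inj_onI)
  fix s t assume "middle_rank n s = middle_rank n t"
  then show "s = t"
    unfolding middle_rank_def by (simp split: if_splits; presburger)
qed

text \<open>Ranks grow with the distance from \<open>n / 2\<close>, and of two mirror positions
  \<open>t\<close> and \<open>n - t\<close> the smaller comes first. This tie rule is why only the
  second interval contains its endpoint \<open>n - t\<close>.\<close>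

lemma middle_rank_less_iff:
  assumes "b < n" "t < n"
  shows "middle_rank n b < middle_rank n t \<longleftrightarrow> t < b \<and> b < n - t \<or> n - t \<le> b \<and> b < t"
  using assms by (auto simp: middle_rank_def)

text \<open>A crossing is determined by its first component. For \<open>i\<close> in
  \<open>A\<close> with larger entry at \<open>j\<close>, one has \<open>\<sigma> i = n - i\<close>;
  the condition \<open>j < \<sigma> i\<close> locates the next gap of \<open>A\<close> after
  \<open>i\<close>, and \<open>\<sigma> j \<le> i\<close> locates the last gap before
  \<open>i\<close>.\<close>

lemma cr_eq_card_non_rl_maxima:
  assumes perm: "\<sigma> permutes {1..n}" and U: "unique_larger_right n \<sigma>"
  defines "A \<equiv> non_rl_maxima n \<sigma>"
  shows "cr n \<sigma> = card {t \<in> A. \<exists>b\<in>{1..n - 1} - A. middle_rank n b < middle_rank n t}"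
proof -
  note less = less_iff_next_rl_maximum[OF perm U, folded A_def]
  have inj: "\<sigma> a = \<sigma> b \<longleftrightarrow> a = b" for a b
    using permutes_inj[OF perm] by (auto dest: injD)
  have uniq: "b = c"
    if "1 \<le> a" "a < b" "a < c" "b \<le> n" "c \<le> n" "\<sigma> a < \<sigma> b" "\<sigma> a < \<sigma> c" for a b c
    using U that unfolding unique_larger_right_def by blast
  have card_larger: "card {k \<in> {1..n}. \<sigma> i < \<sigma> k} = n - \<sigma> i" for i
  proof -
    have "\<sigma> ` {k \<in> {1..n}. \<sigma> i < \<sigma> k} = \<sigma> ` {1..n} \<inter> {\<sigma> i<..}"
      by blast
    also have "\<dots> = {1..n} \<inter> {\<sigma> i<..}"
      using permutes_image[OF perm] by simp
    also have "\<dots> = {\<sigma> i<..n}"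
      by auto
    finally show ?thesis
      using card_image[of \<sigma> "{k \<in> {1..n}. \<sigma> i < \<sigma> k}"] permutes_inj_on[OF perm]
      by (metis card_greaterThanAtMost)
  qed
  have cross: "j < \<sigma> i \<or> \<sigma> j \<le> i \<longleftrightarrow> (\<exists>b\<in>{1..n - 1} - A. middle_rank n b < middle_rank n i)"
    if ij: "1 \<le> i" "i < j" "j \<le> n" "\<sigma> i < \<sigma> j" for i j
  proof -
    have jA: "j \<notin> A" and sub: "{i..<j} \<subseteq> A"
      using less ij by auto
    \<comment> \<open>An earlier \<open>k\<close> with \<open>\<sigma> k < \<sigma> i\<close> would
      have both \<open>i\<close> and \<open>j\<close> as larger entries on its right. Hence exactly
      \<open>i\<close> positions carry a value above \<open>\<sigma> i\<close>.\<close>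
    have "{k \<in> {1..n}. \<sigma> i < \<sigma> k} = insert j {1..<i}"
    proof (intro equalityI subsetI)
      fix k assume "k \<in> {k \<in> {1..n}. \<sigma> i < \<sigma> k}"
      then show "k \<in> insert j {1..<i}"
        using uniq[of i j k] ij by (cases k i rule: linorder_cases) auto
    next
      fix k assume "k \<in> insert j {1..<i}"
      then show "k \<in> {k \<in> {1..n}. \<sigma> i < \<sigma> k}"
        using ij uniq[of k i j] inj[of k i] by (auto intro: ccontr simp: not_less le_less)
    qed
    then have "n - \<sigma> i = i"
      using card_larger[of i] ij by simp
    then have \<sigma>i: "\<sigma> i = n - i"
      using ij by auto
    \<comment> \<open>Since \<open>{i..<j}\<close> lies in \<open>A\<close>, the first gap after
      \<open>i\<close> is \<open>j\<close> itself.\<close>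
    have upper: "j < n - i \<longleftrightarrow> (\<exists>b\<in>{1..n - 1} - A. i < b \<and> b < n - i)"
    proof
      assume "j < n - i"
      with ij jA show "\<exists>b\<in>{1..n - 1} - A. i < b \<and> b < n - i"
        by (intro bexI[of _ j]) auto
    next
      assume "\<exists>b\<in>{1..n - 1} - A. i < b \<and> b < n - i"
      then obtain b where "b \<notin> A" "i < b" "b < n - i"
        by auto
      moreover from this sub have "j \<le> b"
        by (metis atLeastLessThan_iff less_imp_le not_le subsetD)
      ultimately show "j < n - i"
        by simp
    qed
    have \<sigma>jn: "\<sigma> j \<le> n"
      using permutes_in_image[OF perm, of j] ij by auto
    have lower: "\<sigma> j \<le> i \<longleftrightarrow> (\<exists>b\<in>{1..n - 1} - A. n - i \<le> b \<and> b < i)"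
    proof
      assume "\<sigma> j \<le> i"
      define L where "L = {k \<in> {1..n}. \<sigma> j < \<sigma> k}"
      \<comment> \<open>A member of \<open>L\<close> beyond \<open>i\<close> would be a second entry
        larger than \<open>\<sigma> i\<close>, next to \<open>j\<close>.\<close>
      have L_less: "k < i" if "k \<in> L" for k
      proof (rule ccontr)
        assume "\<not> k < i"
        with that ij have "\<sigma> i < \<sigma> k" "k \<noteq> i" "k \<le> n" "\<not> k < i"
          by (auto simp: L_def)
        then have "i < k"
          by simp
        with uniq[of i j k] ij that \<open>\<sigma> i < \<sigma> k\<close> \<open>k \<le> n\<close> show False
          by (auto simp: L_def)
      qed
      have "n - i \<le> card L"
        using card_larger[of j] \<open>\<sigma> j \<le> i\<close> by (simp add: L_def)
      moreover have "finite L"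
        by (simp add: L_def)
      moreover have "L \<noteq> {}"
        using calculation ij by auto
      ultimately have M: "Max L \<in> L"
        by simp
      \<comment> \<open>The size of \<open>L\<close>, at least \<open>n - i\<close>, bounds its
        largest position from below.\<close>
      have "card L \<le> card {1..Max L}"
        using \<open>finite L\<close> by (intro card_mono) (auto simp: L_def)
      with \<open>n - i \<le> card L\<close> have "n - i \<le> Max L"
        by simp
      \<comment> \<open>A larger entry right of \<open>Max L\<close> would again belong to
        \<open>L\<close>.\<close>
      moreover have "Max L \<notin> A"
      proof
        assume "Max L \<in> A"
        then obtain k where k: "Max L < k" "k \<le> n" "\<sigma> (Max L) < \<sigma> k"
          by (auto simp: A_def non_rl_maxima_def)
        with M have "k \<in> L"
          by (auto simp: L_def)
        with \<open>finite L\<close> k show False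
          by (meson Max_ge not_le)
      qed
      moreover have "Max L < i" "1 \<le> Max L"
        using M L_less by (auto simp: L_def)
      ultimately show "\<exists>b\<in>{1..n - 1} - A. n - i \<le> b \<and> b < i"
        using ij by (intro bexI[of _ "Max L"]) auto
    next
      assume "\<exists>b\<in>{1..n - 1} - A. n - i \<le> b \<and> b < i"
      then obtain b where b: "1 \<le> b" "b \<notin> A" "n - i \<le> b" "b < i"
        by auto
      \<comment> \<open>The gap \<open>b\<close> separates each \<open>k \<le> b\<close> from
        \<open>j\<close>, so \<open>\<sigma> k\<close> is above \<open>\<sigma> j\<close>. This
        gives \<open>n - \<sigma> j \<ge> b \<ge> n - i\<close>.\<close>
      have "{1..b} \<subseteq> {k \<in> {1..n}. \<sigma> j < \<sigma> k}"
      proof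
        fix k assume k: "k \<in> {1..b}"
        have "b \<in> {k..<j}"
          using b k ij by auto
        with \<open>b \<notin> A\<close> have "\<not> {k..<j} \<subseteq> A"
          by blast
        with less[of k j] k b ij inj[of k j] show "k \<in> {k \<in> {1..n}. \<sigma> j < \<sigma> k}"
          by auto
      qed
      from card_mono[OF _ this] card_larger[of j] b \<sigma>jn show "\<sigma> j \<le> i"
        by simp
    qed
    have "middle_rank n b < middle_rank n i \<longleftrightarrow> i < b \<and> b < n - i \<or> n - i \<le> b \<and> b < i"
      if "b \<in> {1..n - 1} - A" for b
      using that ij by (intro middle_rank_less_iff) auto
    with upper lower \<sigma>i show ?thesis
      by auto
  qed
  have crossing_iff: "(i, j) \<in> crossings n \<sigma> \<longleftrightarrow>
      1 \<le> i \<and> i < j \<and> j \<le> n \<and> \<sigma> i < \<sigma> j \<and> (j < \<sigma> i \<or> \<sigma> j \<le> i)" for i j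
    unfolding crossings_def by auto
  have "inj_on fst (crossings n \<sigma>)"
  proof (rule inj_onI)
    fix c d assume "c \<in> crossings n \<sigma>" "d \<in> crossings n \<sigma>" "fst c = fst d"
    then show "c = d"
      using uniq[of "fst c" "snd c" "snd d"] by (cases c; cases d) (simp add: crossing_iff)
  qed
  moreover have "fst ` crossings n \<sigma> =
      {t \<in> A. \<exists>b\<in>{1..n - 1} - A. middle_rank n b < middle_rank n t}" (is "_ = ?R")
  proof (intro equalityI subsetI)
    fix t assume "t \<in> fst ` crossings n \<sigma>"
    then obtain j where j: "(t, j) \<in> crossings n \<sigma>"
      by auto
    then have "t \<in> A"
      unfolding crossing_iff A_def non_rl_maxima_def by auto
    with j cross[of t j] show "t \<in> ?R"
      unfolding crossing_iff by blast
  next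
    fix t assume t: "t \<in> ?R"
    then obtain j where j: "1 \<le> t" "t < j" "j \<le> n" "\<sigma> t < \<sigma> j"
      unfolding A_def non_rl_maxima_def by auto
    with t cross[of t j] have "(t, j) \<in> crossings n \<sigma>"
      unfolding crossing_iff by blast
    then show "t \<in> fst ` crossings n \<sigma>"
      by force
  qed
  ultimately show ?thesis
    unfolding cr_def by (metis card_image)
qed

section \<open>Weighted count of subsets by their first gap\<close>

text \<open>The exponent counts the elements of \<open>A\<close> ranked after the first element outside \<open>A\<close>, so
  that first element splits the sum into powers of \<open>1 + q\<close>.\<close>
lemma sum_Pow_power_card_after_gap:
  fixes q :: "'a::comm_ring_1" and r :: "'b \<Rightarrow> nat"
  assumes "finite X" "inj_on r X"
  shows "(\<Sum>A\<in>Pow X. q ^ card {t \<in> A. \<exists>b\<in>X - A. r b < r t}) = 1 + (\<Sum>k<card X. (1 + q) ^ k)"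
  using assms
\<comment> \<open>The element \<open>x\<close> added at each step has the highest rank. The rule
  does not supply \<open>x \<notin> S\<close>, hence the case split.\<close>
proof (induction X rule: finite_ranking_induct[where f = r])
  case empty
  then show ?case
    by simp
next
  case (insert x S)
  show ?case
  proof (cases "x \<in> S")
    case True
    with insert show ?thesis
      by (simp add: insert_absorb)
  next
    case False
    define w where "w X A = card {t \<in> A. \<exists>b\<in>X - A. r b < r t}" for X A
    \<comment> \<open>The full set \<open>S\<close> is the only subset without a gap. It has weight
      1 and is kept apart because it alone gains no factor \<open>q\<close> when \<open>x\<close> is
      added.\<close>
    define g where "g = (\<Sum>A\<in>Pow S - {S}. q ^ w S A)"
    have less: "r t < r x" if "t \<in> S" for t
      using insert.hyps(2)[OF that] insert.prems False that
      by (metis inj_on_contraD insertCI le_neq_implies_less)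
    \<comment> \<open>As a gap of top rank, \<open>x\<close> has no element after it.\<close>
    have w_out: "w (insert x S) A = w S A" if "A \<subseteq> S" for A
    proof -
      have "{t \<in> A. \<exists>b\<in>insert x S - A. r b < r t} = {t \<in> A. \<exists>b\<in>S - A. r b < r t}"
        using that less by (auto dest: less_asym)
      then show ?thesis
        by (simp add: w_def)
    qed
    have w_in: "w (insert x S) (insert x A) = (if A = S then 0 else Suc (w S A))"
      if "A \<subseteq> S" for A
    proof (cases "A = S")
      case True
      then show ?thesis
        by (auto simp: w_def)
    next
      case False
      with that obtain b where "b \<in> S - A"
        by blast
      with that \<open>x \<notin> S\<close> have "{t \<in> insert x A. \<exists>b\<in>insert x S - insert x A. r b < r t} =
          insert x {t \<in> A. \<exists>b\<in>S - A. r b < r t}"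
        using less by (auto dest: less_asym)
      moreover have "finite A" "x \<notin> A"
        using that insert.hyps(1) \<open>x \<notin> S\<close> finite_subset by auto
      ultimately show ?thesis
        using False by (simp add: w_def)
    qed
    have fin: "finite (Pow S)"
      using insert.hyps(1) by simp
    have "w S S = 0"
      by (simp add: w_def)
    then have S: "(\<Sum>A\<in>Pow S. q ^ w S A) = 1 + g"
      unfolding g_def by (subst sum.remove[OF fin, of S]) auto
    then have g: "g = (\<Sum>k<card S. (1 + q) ^ k)"
      using insert.IH insert.prems by (simp add: w_def inj_on_insert)
    have "(\<Sum>A\<in>Pow (insert x S). q ^ w (insert x S) A) =
        (\<Sum>A\<in>Pow S. q ^ w (insert x S) A) + (\<Sum>A\<in>insert x ` Pow S. q ^ w (insert x S) A)"
      unfolding Pow_insert using fin False by (intro sum.union_disjoint) auto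
    also have "(\<Sum>A\<in>Pow S. q ^ w (insert x S) A) = 1 + g"
      using S by (simp add: w_out)
    also have "(\<Sum>A\<in>insert x ` Pow S. q ^ w (insert x S) A) =
        (\<Sum>A\<in>Pow S. q ^ w (insert x S) (insert x A))"
      using False by (subst sum.reindex) (auto simp: inj_on_def)
    also have "\<dots> = 1 + (\<Sum>A\<in>Pow S - {S}. q * q ^ w S A)"
      by (subst sum.remove[OF fin, of S]) (auto simp: w_in intro!: sum.cong)
    also have "\<dots> = 1 + q * g"
      by (simp add: g_def sum_distrib_left)
    \<comment> \<open>Horner's scheme: \<open>1 + (1 + q) * g\<close> extends the geometric sum by
      one term.\<close>
    also have "1 + g + (1 + q * g) = 1 + (1 + (1 + q) * g)"
      by (simp add: algebra_simps)
    also have "1 + (1 + q) * g = (\<Sum>k<card (insert x S). (1 + q) ^ k)"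
      using False insert.hyps(1) by (simp add: g sum.lessThan_Suc_shift sum_distrib_left del: sum.lessThan_Suc)
    finally show ?thesis
      by (simp add: w_def)
  qed
qed

text \<open>The truncated \<open>n - 1\<close> makes the formula cover \<open>n = 0\<close> too,
  with both sides equal to 1.\<close>

lemma sum_power_cr_123_132:
  fixes q :: "'a::comm_ring_1"
  shows "(\<Sum>\<sigma>\<in>avoiders n [1, 2, 3] [1, 3, 2]. q ^ cr n \<sigma>) = 1 + (\<Sum>k<n - 1. (1 + q) ^ k)"
proof -
  let ?w = "\<lambda>A. card {t \<in> A. \<exists>b\<in>{1..n - 1} - A. middle_rank n b < middle_rank n t}"
  have "(\<Sum>\<sigma>\<in>avoiders n [1, 2, 3] [1, 3, 2]. q ^ cr n \<sigma>) =
      (\<Sum>\<sigma>\<in>avoiders n [1, 2, 3] [1, 3, 2]. q ^ ?w (non_rl_maxima n \<sigma>))"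
    by (intro sum.cong refl) (auto simp only: avoiders_123_132 mem_Collect_eq cr_eq_card_non_rl_maxima)
  also have "\<dots> = (\<Sum>A\<in>Pow {1..n - 1}. q ^ ?w A)"
    by (rule sum.reindex_bij_betw[OF bij_betw_non_rl_maxima])
  also have "\<dots> = 1 + (\<Sum>k<n - 1. (1 + q) ^ k)"
    by (subst sum_Pow_power_card_after_gap) (auto intro: inj_on_middle_rank)
  finally show ?thesis .
qed

section \<open>Symmetry between 132 and 213\<close>

text \<open>Fixing everything outside {1..n} makes the reversal a permutation in the sense of
  \<open>permutes\<close>.\<close>

definition flip :: "nat \<Rightarrow> nat \<Rightarrow> nat" where
  "flip n i = (if i \<in> {1..n} then n + 1 - i else i)"

lemma flip_flip [simp]: "flip n (flip n i) = i"
  by (auto simp: flip_def)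

lemma flip_permutes: "flip n permutes {1..n}"
proof (rule bij_imp_permutes)
  show "bij_betw (flip n) {1..n} {1..n}"
    by (rule bij_betwI[where g = "flip n"]) (auto simp: flip_def)
qed (auto simp: flip_def)

text \<open>Reverse-complement and inverse each move the weak inequality in the definition of a crossing
  from one kind of crossing to the other; only their composition preserves the number of crossings.\<close>
definition rev_compl_inv :: "nat \<Rightarrow> (nat \<Rightarrow> nat) \<Rightarrow> nat \<Rightarrow> nat" where
  "rev_compl_inv n \<sigma> = flip n \<circ> inv \<sigma> \<circ> flip n"

lemma rev_compl_inv_permutes:
  "\<sigma> permutes {1..n} \<Longrightarrow> rev_compl_inv n \<sigma> permutes {1..n}"
  unfolding rev_compl_inv_def by (intro permutes_compose flip_permutes permutes_inv)

lemma rev_compl_inv_rev_compl_inv: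
  assumes "\<sigma> permutes {1..n}"
  shows "rev_compl_inv n (rev_compl_inv n \<sigma>) = \<sigma>"
proof -
  have "inv (rev_compl_inv n \<sigma>) = flip n \<circ> \<sigma> \<circ> flip n"
    using permutes_inverses[OF assms]
    by (intro inv_unique_comp) (auto simp: rev_compl_inv_def fun_eq_iff)
  then show ?thesis
    unfolding rev_compl_inv_def[of n "rev_compl_inv n \<sigma>"] by (simp add: fun_eq_iff)
qed

text \<open>Reflection in the antidiagonal sends the graph point \<open>(i, \<sigma> i)\<close> to
  \<open>(\<kappa> i, flip n i)\<close>. Evaluating at \<open>\<kappa> i\<close> keeps the inverse
  permutation out of the later arguments.\<close>

context
  fixes n :: nat and \<sigma> \<kappa> :: "nat \<Rightarrow> nat"
  assumes perm: "\<sigma> permutes {1..n}"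
  defines "\<kappa> \<equiv> flip n \<circ> \<sigma>"
begin

lemma kappa_permutes: "\<kappa> permutes {1..n}"
  unfolding \<kappa>_def by (intro permutes_compose flip_permutes perm)

lemma rev_compl_inv_kappa: "rev_compl_inv n \<sigma> (\<kappa> i) = flip n i"
  using permutes_inverses[OF perm] by (simp add: rev_compl_inv_def \<kappa>_def)

lemma kappa_surj: "i \<in> {1..n} \<Longrightarrow> \<exists>a\<in>{1..n}. i = \<kappa> a"
  using permutes_image[OF kappa_permutes] by blast

lemma kappa_in: "1 \<le> i \<Longrightarrow> i \<le> n \<Longrightarrow> 1 \<le> \<kappa> i \<and> \<kappa> i \<le> n"
  using permutes_in_image[OF kappa_permutes, of i] by simp

lemma kappa_eq_iff: "\<kappa> i = \<kappa> j \<longleftrightarrow> i = j"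
  using permutes_inj[OF kappa_permutes] by (auto dest: injD)

text \<open>The reflection exchanges positions with values and reverses both orders. The last two
  items handle the position-value comparisons in crossings.\<close>

lemma kappa_less_iff:
  assumes "i \<in> {1..n}" "j \<in> {1..n}"
  shows "\<kappa> j < \<kappa> i \<longleftrightarrow> \<sigma> i < \<sigma> j"
    and "rev_compl_inv n \<sigma> (\<kappa> j) < rev_compl_inv n \<sigma> (\<kappa> i) \<longleftrightarrow> i < j"
    and "\<kappa> j < rev_compl_inv n \<sigma> (\<kappa> i) \<longleftrightarrow> i < \<sigma> j"
    and "rev_compl_inv n \<sigma> (\<kappa> i) \<le> \<kappa> j \<longleftrightarrow> \<sigma> j \<le> i"
  using assms permutes_in_image[OF perm, of i] permutes_in_image[OF perm, of j]
  by (auto simp: rev_compl_inv_kappa) (auto simp: \<kappa>_def flip_def)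

text \<open>Larger entries to the right of \<open>i\<close> become smaller entries to the left of
  \<open>\<kappa> i\<close>.\<close>

lemma unique_smaller_left_rev_compl_inv:
  "unique_smaller_left n (rev_compl_inv n \<sigma>) \<longleftrightarrow> unique_larger_right n \<sigma>"
proof
  assume L: "unique_smaller_left n (rev_compl_inv n \<sigma>)"
  show "unique_larger_right n \<sigma>"
    unfolding unique_larger_right_def
  proof clarify
    fix i j k
    assume *: "1 \<le> i" "i < j" "i < k" "j \<le> n" "k \<le> n" "\<sigma> i < \<sigma> j" "\<sigma> i < \<sigma> k"
    then have "\<kappa> j = \<kappa> k"
      using L[unfolded unique_smaller_left_def, rule_format, of "\<kappa> j" "\<kappa> k" "\<kappa> i"]
      using kappa_in[of i] kappa_in[of j] kappa_in[of k] * by (simp add: kappa_less_iff)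
    then show "j = k"
      by (simp add: kappa_eq_iff)
  qed
next
  assume U: "unique_larger_right n \<sigma>"
  show "unique_smaller_left n (rev_compl_inv n \<sigma>)"
    unfolding unique_smaller_left_def
  proof clarify
    fix i j k
    assume *: "1 \<le> i" "1 \<le> j" "i < k" "j < k" "k \<le> n"
      "rev_compl_inv n \<sigma> i < rev_compl_inv n \<sigma> k" "rev_compl_inv n \<sigma> j < rev_compl_inv n \<sigma> k"
    then obtain a b c where abc: "a \<in> {1..n}" "b \<in> {1..n}" "c \<in> {1..n}"
        "i = \<kappa> a" "j = \<kappa> b" "k = \<kappa> c"
      using kappa_surj[of i] kappa_surj[of j] kappa_surj[of k] by auto
    with * have "c < a" "c < b" "\<sigma> c < \<sigma> a" "\<sigma> c < \<sigma> b"
      by (simp_all add: kappa_less_iff)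
    with U abc show "i = j"
      unfolding unique_larger_right_def by (metis atLeastAtMost_iff)
  qed
qed

text \<open>The pair \<open>(i, j)\<close> goes to \<open>(\<kappa> j, \<kappa> i)\<close>, swapped
  because \<open>\<sigma> i < \<sigma> j\<close> turns into \<open>\<kappa> j < \<kappa> i\<close>.
  Each kind of crossing is carried to the same kind.\<close>

lemma cr_rev_compl_inv: "cr n (rev_compl_inv n \<sigma>) = cr n \<sigma>"
proof -
  have iff: "(\<kappa> j, \<kappa> i) \<in> crossings n (rev_compl_inv n \<sigma>) \<longleftrightarrow> (i, j) \<in> crossings n \<sigma>"
    if "i \<in> {1..n}" "j \<in> {1..n}" for i j
    using that kappa_in[of i] kappa_in[of j] by (auto simp: crossings_def kappa_less_iff)
  have in_range: "i \<in> {1..n} \<and> j \<in> {1..n}" if "(i, j) \<in> crossings n \<pi>" for i j \<pi>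
    using that by (auto simp: crossings_def)
  have "bij_betw (\<lambda>(i, j). (\<kappa> j, \<kappa> i)) (crossings n \<sigma>) (crossings n (rev_compl_inv n \<sigma>))"
    unfolding bij_betw_def
  proof (intro conjI equalityI subsetI)
    fix p assume p: "p \<in> crossings n (rev_compl_inv n \<sigma>)"
    obtain i j where "p = (\<kappa> j, \<kappa> i)" "i \<in> {1..n}" "j \<in> {1..n}"
      using p in_range kappa_surj by (metis surj_pair)
    with p iff show "p \<in> (\<lambda>(i, j). (\<kappa> j, \<kappa> i)) ` crossings n \<sigma>"
      by force
  qed (use iff in_range in \<open>auto simp: inj_on_def kappa_eq_iff\<close>)
  then show ?thesis
    unfolding cr_def by (simp add: bij_betw_same_card)
qed

end

lemma unique_larger_right_rev_compl_inv:
  assumes "\<sigma> permutes {1..n}"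
  shows "unique_larger_right n (rev_compl_inv n \<sigma>) \<longleftrightarrow> unique_smaller_left n \<sigma>"
  using unique_smaller_left_rev_compl_inv[OF rev_compl_inv_permutes[OF assms]]
  by (simp add: rev_compl_inv_rev_compl_inv[OF assms])

lemma sum_power_cr_123_213:
  fixes q :: "'a::comm_semiring_1"
  shows "(\<Sum>\<sigma>\<in>avoiders n [1, 2, 3] [2, 1, 3]. q ^ cr n \<sigma>) =
    (\<Sum>\<sigma>\<in>avoiders n [1, 2, 3] [1, 3, 2]. q ^ cr n \<sigma>)"
  unfolding avoiders_123_213 avoiders_123_132
  by (rule sum.reindex_bij_witness[where i = "rev_compl_inv n" and j = "rev_compl_inv n"])
    (simp_all add: rev_compl_inv_permutes rev_compl_inv_rev_compl_inv cr_rev_compl_inv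
      unique_smaller_left_rev_compl_inv unique_larger_right_rev_compl_inv
      del: One_nat_def)

section \<open>The generating function\<close>

text \<open>Multiplying by \<open>1 - fps_X\<close> takes differences and leaves a geometric tail;
  multiplying by \<open>1 - fps_const a * fps_X\<close> cancels that tail and leaves the
  numerator.\<close>

lemma fps_geometric_sum:
  fixes a :: "'a::field"
  shows "Abs_fps (\<lambda>n. if n = 0 then 0 else 1 + (\<Sum>k<n - 1. a ^ k)) =
    fps_X * (1 - fps_const (a - 1) * fps_X) / ((1 - fps_X) * (1 - fps_const a * fps_X))"
    (is "?G = ?N / ?D")
proof -
  have GH: "(1 - fps_X) * ?G = Abs_fps (\<lambda>n. if n = 0 then 0 else if n = 1 then 1 else a ^ (n - 2))"
    (is "_ = ?H")
  proof (rule fps_ext)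
    fix n
    consider "n = 0" | "n = 1" | m where "n = Suc (Suc m)"
      by (metis One_nat_def not0_implies_Suc)
    then show "fps_nth ((1 - fps_X) * ?G) n = fps_nth ?H n"
      by cases (auto simp: left_diff_distrib)
  qed
  have HN: "(1 - fps_const a * fps_X) * ?H = ?N"
  proof (rule fps_ext)
    fix n
    \<comment> \<open>The tail starts at degree 2, so cancellation begins at degree 3.\<close>
    consider "n = 0" | "n = 1" | "n = 2" | m where "n = Suc (Suc (Suc m))"
      by (metis One_nat_def numeral_2_eq_2 not0_implies_Suc)
    then show "fps_nth ((1 - fps_const a * fps_X) * ?H) n = fps_nth ?N n"
      by cases (auto simp: left_diff_distrib mult.assoc numeral_2_eq_2)
  qed
  have "?G * ?D = (1 - fps_const a * fps_X) * ((1 - fps_X) * ?G)"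
    by (simp only: ac_simps)
  then have GD: "?G * ?D = ?N"
    by (simp only: GH HN)
  \<comment> \<open>The constant coefficient of the denominator is 1.\<close>
  have "?D \<noteq> 0"
  proof
    assume "?D = 0"
    then have "fps_nth ?D 0 = 0"
      by simp
    then show False
      by simp
  qed
  from nonzero_mult_div_cancel_right[OF this, of ?G] show ?thesis
    unfolding GD by (rule sym)
qed

theorem mainTheorem7:
  fixes q :: "'a::field" and \<tau> :: "nat list"
  assumes "\<tau> \<in> {[1, 3, 2], [2, 1, 3]}"
  shows "F [1, 2, 3] \<tau> q =
    1 + fps_X * (1 - fps_const q * fps_X) /
        ((1 - fps_X) * (1 - (1 + fps_const q) * fps_X))"
proof -
  have "(\<Sum>\<sigma>\<in>avoiders n [1, 2, 3] \<tau>. q ^ cr n \<sigma>) = 1 + (\<Sum>k<n - 1. (1 + q) ^ k)" for n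
    using assms sum_power_cr_123_132[of q n] sum_power_cr_123_213[of q n] by auto
  \<comment> \<open>The coefficient at \<open>n = 0\<close> is the summand 1 split off. The rest is
    the series above with \<open>a = 1 + q\<close>, so that \<open>a - 1 = q\<close>.\<close>
  then have "F [1, 2, 3] \<tau> q = 1 + Abs_fps (\<lambda>n. if n = 0 then 0 else 1 + (\<Sum>k<n - 1. (1 + q) ^ k))"
    by (auto simp: F_def fps_eq_iff)
  then show ?thesis
    unfolding fps_geometric_sum by (simp flip: fps_const_add)
qed

end
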